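(* Let $\bar{\mathcal{G}}=(\bar A,\bar B,\bar S,\bar T)$ be a reduced game of the constrained bi-matrix game $\mathcal{G}=(A,B,S,T)$ (obtained from $t\in\mathbb{R}\setminus\{0\}$ and matrices $U,V,\Sigma$) such that $A=U\bar A V^{\top}$ and $B=U\bar B V^{\top}$. Then, for $(x,y)\in\mathbb{R}^m\times\mathbb{R}^n$, $(x,y)\in\operatorname{Nash}(\mathcal{G})$ if and only if $$(U^{\top}x,\,V^{\top}y)\in\operatorname{Nash}(\bar{\mathcal{G}})\quad\text{and}\quad(x,y)\in S\times T.$$
   Context: A constrained bi-matrix game $\mathcal{G}=(A,B,S,T)$ consists of $A,B\in\mathbb{R}^{m\times n}$ and nonempty convex polytopes $S\subseteq\mathbb{R}^m$, $T\subseteq\mathbb{R}^n$. $\operatorname{Nash}(\mathcal{G})$ is the set of Nash equilibria: pairs $(x,y)\in S\times T$ with $x\in\arg\max_{x'\in S}y^{\top}A^{\top}x'$ and $y\in\arg\max_{y'\in T}x^{\top}By'$. Reduced game: with $t\in\mathbb{R}\setminus\{0\}$ fixed and $k=\operatorname{rank}(A+tB)$, let $A+tB=U\Sigma V^{\top}$ with $U\in\mathbb{R}^{m\times k}$, $V\in\mathbb{R}^{n\times k}$, $U^{\top}U=I_k$, $V^{\top}V=I_k$, and $\Sigma\in\mathbb{R}^{k\times k}$ diagonal containing the $k$ nonzero singular values of $A+tB$. The reduced game is $\bar{\mathcal{G}}=(\bar A,\bar B,\bar S,\bar T)$ with $\bar A=U^{\top}AV$, $\bar B=U^{\top}BV$,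 $\bar S=U^{\top}[S]=\{U^{\top}x\mid x\in S\}$, $\bar T=V^{\top}[T]=\{V^{\top}y\mid y\in T\}$; it is itself a constrained bi-matrix game. *)

theory Defs
  imports Complex_Main "Jordan_Normal_Form.DL_Rank" "Jordan_Normal_Form.Char_Poly"
begin

text \<open>
  The matrices and vectors of Jordan-Normal-Form have natural numbers as dimensions. This allows
  the dimension of the reduced game to be the rank of a matrix, including rank zero, which an
  index type (always nonempty) would exclude. These vectors are not an instance of the class of
  real vector spaces, so convex hulls and polytopes are defined for them here.
\<close>

definition vec_convex_hull :: "nat \<Rightarrow> real vec set \<Rightarrow> real vec set" where
  "vec_convex_hull n P =
    {vec n (\<lambda>i. \<Sum>p\<in>P. c p * p $ i) | c. (\<forall>p\<in>P. 0 \<le> c p) \<and> (\<Sum>p\<in>P. c p) = 1}"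

definition vec_polytope :: "nat \<Rightarrow> real vec set \<Rightarrow> bool" where
  "vec_polytope n S \<longleftrightarrow> (\<exists>P \<subseteq> carrier_vec n. finite P \<and> S = vec_convex_hull n P)"

type_synonym game = "real mat \<times> real mat \<times> real vec set \<times> real vec set"

fun constrained_bimatrix_game :: "nat \<Rightarrow> nat \<Rightarrow> game \<Rightarrow> bool" where
  "constrained_bimatrix_game m n (A, B, S, T) \<longleftrightarrow>
    A \<in> carrier_mat m n \<and> B \<in> carrier_mat m n \<and>
    vec_polytope m S \<and> S \<noteq> {} \<and> vec_polytope n T \<and> T \<noteq> {}"

fun Nash :: "game \<Rightarrow> (real vec \<times> real vec) set" where
  "Nash (A, B, S, T) = {(x, y) \<in> S \<times> T.
    is_arg_max (\<lambda>x'. y \<bullet> (A\<^sup>T *\<^sub>v x')) (\<lambda>x'. x' \<in> S) x \<and>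
    is_arg_max (\<lambda>y'. x \<bullet> (B *\<^sub>v y')) (\<lambda>y'. y' \<in> T) y}"

text \<open>
  The nonzero singular values of \<open>M\<close>, with multiplicity: the square roots of the nonzero
  eigenvalues of \<open>M\<^sup>T * M\<close>, counted with algebraic multiplicity.
\<close>

definition nonzero_singular_values :: "real mat \<Rightarrow> real multiset" where
  "nonzero_singular_values M =
    image_mset sqrt (filter_mset (\<lambda>e. e \<noteq> 0) (proots (char_poly (M\<^sup>T * M))))"

definition compact_svd :: "real mat \<Rightarrow> real mat \<Rightarrow> real mat \<Rightarrow> real mat \<Rightarrow> bool" where
  "compact_svd M U \<Sigma> V \<longleftrightarrow> (let k = vec_space.rank (dim_row M) M in
    U \<in> carrier_mat (dim_row M) k \<and> \<Sigma> \<in> carrier_mat k k \<and> V \<in> carrier_mat (dim_col M) k \<and>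
    U\<^sup>T * U = 1\<^sub>m k \<and> V\<^sup>T * V = 1\<^sub>m k \<and>
    diagonal_mat \<Sigma> \<and> mset (diag_mat \<Sigma>) = nonzero_singular_values M \<and>
    M = U * \<Sigma> * V\<^sup>T)"

fun is_reduced_game :: "game \<Rightarrow> real \<Rightarrow> real mat \<Rightarrow> real mat \<Rightarrow> real mat \<Rightarrow> game \<Rightarrow> bool" where
  "is_reduced_game (A, B, S, T) t U \<Sigma> V (A', B', S', T') \<longleftrightarrow>
    t \<noteq> 0 \<and> compact_svd (A + t \<cdot>\<^sub>m B) U \<Sigma> V \<and>
    A' = U\<^sup>T * A * V \<and> B' = U\<^sup>T * B * V \<and>
    S' = (\<lambda>x. U\<^sup>T *\<^sub>v x) ` S \<and> T' = (\<lambda>y. V\<^sup>T *\<^sub>v y) ` T"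

end

theory Submission
  imports Defs
begin

text \<open>Substituting the factorizations of A and B into the payoffs and moving the outer factors
  across the inner product by adjointness turns the payoffs of (x, y) into the payoffs of the
  reduced game at (U^T x, V^T y); this is \<open>scalar_prod_factorization\<close>. With the
  opponent's strategy fixed, the original objective is thus the reduced objective composed with the
  map that sends S onto S' (or T onto T'), and maximizers correspond under such a composition
  (\<open>is_arg_max_image\<close>). Each of the two equilibrium conditions therefore transfers in
  both directions. Membership in S \<times> T must be kept on the right-hand side, since U^T x may
  lie in S' for some x outside S, and likewise for y.\<close>

lemma vec_polytope_subset_carrier:
  assumes "vec_polytope n S"
  shows "S \<subseteq> carrier_vec n"
  using assms by (auto simp: vec_polytope_def vec_convex_hull_def)

text \<open>Adjointness of U and U^T. The middle factor may be rectangular and the outer factors are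
  arbitrary, so that the same identity serves the second player with (U, B', V) and the first player
  with (V, A'^T, U).\<close>

lemma scalar_prod_factorization:
  fixes U V M :: "real mat"
  assumes U: "U \<in> carrier_mat m k" and M: "M \<in> carrier_mat k l" and V: "V \<in> carrier_mat n l"
    and x: "x \<in> carrier_vec m" and y: "y \<in> carrier_vec n"
  shows "x \<bullet> ((U * M * V\<^sup>T) *\<^sub>v y) = (U\<^sup>T *\<^sub>v x) \<bullet> (M *\<^sub>v (V\<^sup>T *\<^sub>v y))"
proof -
  have Vy: "V\<^sup>T *\<^sub>v y \<in> carrier_vec l"
    using V y by simp
  have "(U * M * V\<^sup>T) *\<^sub>v y = (U * M) *\<^sub>v (V\<^sup>T *\<^sub>v y)"
    by (rule assoc_mult_mat_vec) (use U M V y in auto)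
  also have "\<dots> = U *\<^sub>v (M *\<^sub>v (V\<^sup>T *\<^sub>v y))"
    by (rule assoc_mult_mat_vec) (use U M Vy in auto)
  finally have "(U * M * V\<^sup>T) *\<^sub>v y = U *\<^sub>v (M *\<^sub>v (V\<^sup>T *\<^sub>v y))" .
  moreover have "(U\<^sup>T *\<^sub>v x) \<bullet> (M *\<^sub>v (V\<^sup>T *\<^sub>v y)) = x \<bullet> (U *\<^sub>v (M *\<^sub>v (V\<^sup>T *\<^sub>v y)))"
    by (rule transpose_vec_mult_scalar[OF U _ x]) (use M Vy in auto)
  ultimately show ?thesis
    by simp
qed

text \<open>No injectivity of \<open>h\<close> is required: every competitor in the image is
  \<open>h z\<close> for some \<open>z\<close> in \<open>S\<close>, and its value under
  \<open>g\<close> is \<open>f z\<close>, so a strictly better point exists on one side exactly when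
  it exists on the other.\<close>

lemma is_arg_max_image:
  assumes "x \<in> S" and "\<And>z. z \<in> S \<Longrightarrow> f z = g (h z)"
  shows "is_arg_max g (\<lambda>z. z \<in> h ` S) (h x) \<longleftrightarrow> is_arg_max f (\<lambda>z. z \<in> S) x"
  using assms by (auto simp: is_arg_max_def)

theorem proposition4p1:
  fixes A B U \<Sigma> V A' B' :: "real mat" and S T S' T' :: "real vec set"
    and t :: real and m n :: nat and x y :: "real vec"
  assumes "constrained_bimatrix_game m n (A, B, S, T)"
    and "is_reduced_game (A, B, S, T) t U \<Sigma> V (A', B', S', T')"
    and "A = U * A' * V\<^sup>T" and "B = U * B' * V\<^sup>T"
    and "x \<in> carrier_vec m" and "y \<in> carrier_vec n"
  shows "(x, y) \<in> Nash (A, B, S, T) \<longleftrightarrow>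
    (U\<^sup>T *\<^sub>v x, V\<^sup>T *\<^sub>v y) \<in> Nash (A', B', S', T') \<and> (x, y) \<in> S \<times> T"
proof (cases "(x, y) \<in> S \<times> T")
  case False
  then show ?thesis by auto
next
  case True
  then have xS: "x \<in> S" and yT: "y \<in> T" by auto
  have A: "A \<in> carrier_mat m n" and B: "B \<in> carrier_mat m n"
    and S: "S \<subseteq> carrier_vec m" and T: "T \<subseteq> carrier_vec n"
    using assms(1) by (auto dest: vec_polytope_subset_carrier)
  define k where "k = vec_space.rank m (A + t \<cdot>\<^sub>m B)"
  have svd: "compact_svd (A + t \<cdot>\<^sub>m B) U \<Sigma> V"
    and A'_def: "A' = U\<^sup>T * A * V" and B'_def: "B' = U\<^sup>T * B * V"
    and S': "S' = (\<lambda>x. U\<^sup>T *\<^sub>v x) ` S" and T': "T' = (\<lambda>y. V\<^sup>T *\<^sub>v y) ` T"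
    using assms(2) by simp_all
  \<comment> \<open>\<open>compact_svd\<close> takes the rank in the space of dimension
    \<open>dim_row\<close> of the matrix; rewriting this to \<open>m\<close> identifies it with
    \<open>k\<close>. The dimensions of a matrix sum are those of its second summand, hence the
    appeal to \<open>B\<close>.\<close>
  have dims: "dim_row (A + t \<cdot>\<^sub>m B) = m" "dim_col (A + t \<cdot>\<^sub>m B) = n"
    using B by simp_all
  have U: "U \<in> carrier_mat m k" and V: "V \<in> carrier_mat n k"
    using svd unfolding compact_svd_def Let_def dims k_def by blast+
  have A': "A' \<in> carrier_mat k k" and B': "B' \<in> carrier_mat k k"
    unfolding A'_def B'_def using A B U V by simp_all
  \<comment> \<open>The first player's payoff is written with the transpose of A and with y on the
    left, so the factorization is needed with U and V exchanged.\<close>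
  have AT: "A\<^sup>T = V * A'\<^sup>T * U\<^sup>T"
  proof -
    have "A\<^sup>T = V\<^sup>T\<^sup>T * (U * A')\<^sup>T"
      unfolding assms(3) by (rule transpose_mult) (use U V A' in auto)
    also have "(U * A')\<^sup>T = A'\<^sup>T * U\<^sup>T"
      by (rule transpose_mult[OF U A'])
    also have "V\<^sup>T\<^sup>T * (A'\<^sup>T * U\<^sup>T) = V * A'\<^sup>T * U\<^sup>T"
      using U V A' by (simp add: assoc_mult_mat[of _ n k _ k _ m])
    finally show ?thesis .
  qed
  \<comment> \<open>Here y stays fixed and x' ranges over S, with U^T as the map onto S'; the second
    player's condition is treated symmetrically, with x fixed and V^T mapping T onto T'.\<close>
  have "is_arg_max (\<lambda>x'. (V\<^sup>T *\<^sub>v y) \<bullet> (A'\<^sup>T *\<^sub>v x')) (\<lambda>x'. x' \<in> S') (U\<^sup>T *\<^sub>v x) \<longleftrightarrow>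
      is_arg_max (\<lambda>x'. y \<bullet> (A\<^sup>T *\<^sub>v x')) (\<lambda>x'. x' \<in> S) x"
    unfolding S' AT
    by (rule is_arg_max_image[OF xS], rule scalar_prod_factorization[OF V _ U assms(6)])
      (use S A' in auto)
  moreover have "is_arg_max (\<lambda>y'. (U\<^sup>T *\<^sub>v x) \<bullet> (B' *\<^sub>v y')) (\<lambda>y'. y' \<in> T') (V\<^sup>T *\<^sub>v y) \<longleftrightarrow>
      is_arg_max (\<lambda>y'. x \<bullet> (B *\<^sub>v y')) (\<lambda>y'. y' \<in> T) y"
    unfolding T' assms(4)
    by (rule is_arg_max_image[OF yT], rule scalar_prod_factorization[OF U B' V assms(5)])
      (use T in auto)
  moreover have "U\<^sup>T *\<^sub>v x \<in> S'" "V\<^sup>T *\<^sub>v y \<in> T'"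
    using xS yT S' T' by auto
  ultimately show ?thesis
    using xS yT by simp
qed

end
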